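(* Let $P \in \mathbb{Z}[x]$ be a polynomial of degree $d \geq 2$, and let $(m_n)_{n \geq 1}$ be a sequence of pairwise distinct integers such that, for some $t \in \mathbb{N}$, $|m_n| \leq n^t$ for all $n \geq n(t)$. Then for almost all $\alpha \in \mathbb{R}$ (with respect to Lebesgue measure) the discrepancy $D_N$ of the sequence $(\{P(m_n)\alpha\})_{n \geq 1}$ satisfies the following: for every $\varepsilon > 0$ there are infinitely many $N$ with $$N D_N \geq N^{\frac12 - \varepsilon}.$$
   Context: For real $x$, $\{x\}$ denotes the fractional part of $x$. For a sequence $(x_n)_{n\ge1}$ in $[0,1)$, its discrepancy is $$D_N = \sup_{0 \leq a < b \leq 1} \left| \frac{A_N([a,b))}{N} - (b-a) \right|, \qquad A_N([a,b)) = \#\{1 \leq n \leq N : x_n \in [a,b)\}.$$ *)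

theory Defs
  imports "HOL-Analysis.Analysis" "HOL-Computational_Algebra.Polynomial"
begin

definition count_in :: "(nat \<Rightarrow> real) \<Rightarrow> nat \<Rightarrow> real \<Rightarrow> real \<Rightarrow> nat" where
  "count_in x N a b = card {n \<in> {1..N}. x n \<in> {a..<b}}"

definition discrepancy :: "(nat \<Rightarrow> real) \<Rightarrow> nat \<Rightarrow> real" where
  "discrepancy x N = (SUP (a, b) \<in> {(a, b). 0 \<le> a \<and> a < b \<and> b \<le> 1}.
      \<bar>real (count_in x N a b) / real N - (b - a)\<bar>)"

end

theory Submission
  imports Defs "HOL-Computational_Algebra.Primes"
begin

text \<open>
  By Koksma's inequality, \<open>N D\<^sub>N\<close> is at least a constant times
  \<open>h\<^sup>-\<^sup>1 |\<Sum>\<^bsub>n\<le>N\<^esub> e(h P(m\<^sub>n) \<alpha>)|\<close> for every \<open>h \<ge> 1\<close>. Squaring the sum and adding over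
  \<open>h \<le> H = \<lceil>N\<^sup>\<delta>\<rceil>\<close>, the pairs with \<open>P(m\<^sub>a) = P(m\<^sub>b)\<close> contribute at least \<open>H N\<close>. The second moment
  of the remaining part is at most the number of solutions of
  \<open>h (P(m\<^sub>a) - P(m\<^sub>b)) = \<plusminus> h' (P(m\<^sub>c) - P(m\<^sub>d)) \<noteq> 0\<close>. Given the left-hand side \<open>W\<close>, each of \<open>h'\<close>,
  \<open>P(m\<^sub>c) - P(m\<^sub>d)\<close> and \<open>m\<^sub>c - m\<^sub>d\<close> divides \<open>W\<close>, and they determine \<open>m\<^sub>d\<close> up to \<open>deg P\<close> choices;
  so the divisor bound gives \<open>O(H N\<^bsup>2+\<eta>\<^esup>)\<close> solutions for every \<open>\<eta> > 0\<close>. This is linear in \<open>H\<close>, while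
  the squared mean \<open>(H N)\<^sup>2\<close> is quadratic: averaging over the dilations \<open>h\<close> absorbs the loss
  \<open>N\<^sup>\<eta>\<close>. Chebyshev and Borel--Cantelli along \<open>N = 2\<^sup>k\<close> give, for almost all \<open>\<alpha>\<close> and all large
  \<open>k\<close>, some \<open>h \<le> H\<close> whose exponential sum has modulus at least \<open>\<surd>(N/2)\<close>.
\<close>

section \<open>Divisor bound and root counts for polynomial differences\<close>

lemma card_divisors_mult_le:
  fixes a b :: nat
  assumes "a > 0" "b > 0"
  shows "card {d. d dvd a * b} \<le> card {d. d dvd a} * card {d. d dvd b}"
proof -
  have fin: "finite {d. d dvd a}" "finite {d. d dvd b}"
    using assms by auto
  have "{d. d dvd a * b} \<subseteq> (\<lambda>(x, y). x * y) ` ({d. d dvd a} \<times> {d. d dvd b})"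
    by (auto dest!: division_decomp)
  then have "card {d. d dvd a * b} \<le> card ({d. d dvd a} \<times> {d. d dvd b})"
    using fin by (intro surj_card_le) auto
  then show ?thesis
    by (simp add: card_cartesian_product)
qed

lemma card_divisors_prime_power_le:
  fixes p :: nat
  assumes "prime p"
  shows "card {d. d dvd p ^ k} \<le> Suc k"
proof -
  have "{d. d dvd p ^ k} = (\<lambda>i. p ^ i) ` {..k}"
    using divides_primepow_nat[OF assms] by auto
  then show ?thesis
    using card_image_le[of "{..k}" "\<lambda>i. p ^ i"] by simp
qed

text \<open>This bounds what one small prime costs in the divisor bound. With
  \<open>x = a * (\<eta> * ln 2)\<close> it is \<open>1 + x \<le> exp x\<close>, scaled by a
  constant \<open>K\<close> with both \<open>K \<ge> 1\<close> and
  \<open>K * (\<eta> * ln 2) \<ge> 1\<close>; the constant does not depend on \<open>p\<close>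
  because \<open>p \<ge> 2\<close>.\<close>

lemma linear_le_const_mult_powr:
  fixes \<eta> p :: real
  assumes "\<eta> > 0" "p \<ge> 2"
  shows "real (Suc a) \<le> max 1 (1 / (\<eta> * ln 2)) * (p ^ a) powr \<eta>"
proof -
  define K where "K = max 1 (1 / (\<eta> * ln 2))"
  have K: "K \<ge> 1" "K * (\<eta> * ln 2) \<ge> 1"
  proof -
    show "K \<ge> 1" by (simp add: K_def)
    have "1 / (\<eta> * ln 2) \<le> K" by (simp add: K_def)
    then show "K * (\<eta> * ln 2) \<ge> 1"
      using assms(1) by (simp add: pos_divide_le_eq)
  qed
  have "real (Suc a) \<le> K + real a * (K * (\<eta> * ln 2))"
    using K mult_left_mono[OF K(2), of "real a"] by simp
  also have "\<dots> = K * (1 + real a * (\<eta> * ln 2))"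
    by (simp add: algebra_simps)
  also have "\<dots> \<le> K * exp (real a * (\<eta> * ln 2))"
    using K(1) by (intro mult_left_mono exp_ge_add_one_self) auto
  also have "exp (real a * (\<eta> * ln 2)) = (2 ^ a) powr \<eta>"
    by (simp add: powr_def ln_realpow mult_ac)
  also have "K * (2 ^ a) powr \<eta> \<le> K * (p ^ a) powr \<eta>"
    using K(1) assms by (intro mult_left_mono powr_mono2 power_mono) auto
  finally show ?thesis by (simp add: K_def)
qed

text \<open>Only primes below \<open>2 powr (1/\<eta>)\<close> contribute a factor larger than one to
  the quotient of the divisor function by \<open>n powr \<eta>\<close>.\<close>

lemma card_divisors_le_powr:
  fixes \<eta> :: real
  assumes "\<eta> > 0"
  obtains C where "C > 0" "\<And>n::nat. n > 0 \<Longrightarrow> real (card {d. d dvd n}) \<le> C * real n powr \<eta>"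
proof -
  define K where "K = max 1 (1 / (\<eta> * ln 2))"
  define Q where "Q = nat \<lceil>2 powr (1 / \<eta>)\<rceil>"
  define S where "S n = {p. prime p \<and> p dvd n \<and> p < Q}" for n :: nat
  have K1: "K \<ge> 1" by (simp add: K_def)
  have finS: "finite (S n)" for n
    by (rule finite_subset[of _ "{..<Q}"]) (auto simp: S_def)
  \<comment> \<open>The induction strips off the full power \<open>p ^ a\<close> of one prime, so
    \<open>p\<close> does not divide the cofactor \<open>r\<close>. A prime below \<open>Q\<close>
    costs one factor \<open>K\<close> and is new in \<open>S n\<close>; a prime
    \<open>p \<ge> Q\<close> has \<open>p powr \<eta> \<ge> 2\<close>, and
    \<open>Suc a \<le> 2 ^ a\<close> then costs nothing.\<close>
  have main: "real (card {d. d dvd n}) \<le> K ^ card (S n) * real n powr \<eta>" if "n > 0" for n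
    using that
  proof (induction n rule: less_induct)
    case (less n)
    show ?case
    proof (cases "n = 1")
      case True
      then have "S n = {}" by (auto simp: S_def)
      then show ?thesis using True by simp
    next
      case False
      then obtain p where p: "prime p" "p dvd n"
        using prime_factor_nat by blast
      define a where "a = multiplicity p n"
      obtain r where r: "n = p ^ a * r" "\<not> p dvd r"
        using multiplicity_decompose'[of n p] p less.prems unfolding a_def
        by (metis not_prime_unit not_gr_zero)
      have a: "a > 0"
        using p(2) r by (metis gr0I mult_1 power_0)
      have r0: "r > 0" using less.prems r by (cases r) auto
      have p2: "p \<ge> 2" using p(1) by (rule prime_ge_2_nat)
      have "p ^ 1 \<le> p ^ a"
        using a p2 by (intro power_increasing) auto
      then have "2 * r \<le> p ^ a * r"
        using p2 by (intro mult_right_mono) auto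
      then have "r < n"
        using r(1) r0 by linarith
      note IH = less.IH[OF this r0]
      have "real (card {d. d dvd n}) \<le> real (card {d. d dvd p ^ a}) * real (card {d. d dvd r})"
        unfolding r(1) of_nat_mult[symmetric] of_nat_le_iff
        using p2 r0 by (intro card_divisors_mult_le) auto
      also have "\<dots> \<le> real (Suc a) * (K ^ card (S r) * real r powr \<eta>)"
        using IH card_divisors_prime_power_le[OF p(1), of a] by (intro mult_mono) auto
      also have "\<dots> \<le> K ^ card (S n) * real n powr \<eta>"
      proof (cases "p < Q")
        case True
        have "S n = insert p (S r)"
          using p True r a
          by (auto simp: S_def prime_dvd_mult_iff prime_dvd_power_iff dest: primes_dvd_imp_eq)
        moreover have "p \<notin> S r" using r by (simp add: S_def)
        ultimately have c: "card (S n) = Suc (card (S r))"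
          using finS by simp
        have "real (Suc a) * (K ^ card (S r) * real r powr \<eta>)
            \<le> (K * (real p ^ a) powr \<eta>) * (K ^ card (S r) * real r powr \<eta>)"
          using linear_le_const_mult_powr[OF assms, of "real p" a] p2 K1
          by (intro mult_right_mono) (auto simp: K_def)
        also have "\<dots> = K ^ card (S n) * real n powr \<eta>"
          unfolding c using r(1) by (simp add: powr_mult mult_ac)
        finally show ?thesis .
      next
        case False
        then have "2 powr (1 / \<eta>) \<le> real p"
          unfolding Q_def by linarith
        then have "(2 powr (1 / \<eta>)) powr \<eta> \<le> real p powr \<eta>"
          using assms by (intro powr_mono2) auto
        then have "2 \<le> real p powr \<eta>"
          using assms by (simp add: powr_powr)
        then have "2 ^ a \<le> (real p powr \<eta>) ^ a"
          by (intro power_mono) auto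
        also have "\<dots> = (real p ^ a) powr \<eta>"
          using p2 by (simp add: powr_powr mult.commute flip: powr_realpow)
        finally have pa: "2 ^ a \<le> (real p ^ a) powr \<eta>" .
        have "Suc a \<le> 2 ^ a"
          by (simp add: Suc_leI)
        then have "real (Suc a) \<le> 2 ^ a"
          by (metis of_nat_le_iff of_nat_numeral of_nat_power)
        with pa have "real (Suc a) \<le> (real p ^ a) powr \<eta>" by linarith
        moreover have "card (S r) \<le> card (S n)"
          using finS by (intro card_mono) (auto simp: S_def r(1))
        then have "K ^ card (S r) \<le> K ^ card (S n)"
          using K1 by (rule power_increasing)
        ultimately have "real (Suc a) * (K ^ card (S r) * real r powr \<eta>)
            \<le> (real p ^ a) powr \<eta> * (K ^ card (S n) * real r powr \<eta>)"
          using K1 by (intro mult_mono) auto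
        also have "\<dots> = K ^ card (S n) * real n powr \<eta>"
          by (simp add: r(1) powr_mult mult_ac)
        finally show ?thesis .
      qed
      finally show ?thesis .
    qed
  qed
  show ?thesis
  proof (rule that[of "K ^ Q"])
    show "K ^ Q > 0" using K1 by simp
    fix n :: nat assume n: "n > 0"
    \<comment> \<open>All primes in \<open>S n\<close> lie below \<open>Q\<close>, which makes the
      constant independent of \<open>n\<close>.\<close>
    have "card (S n) \<le> card {..<Q}"
      by (intro card_mono) (auto simp: S_def)
    then have "K ^ card (S n) \<le> K ^ Q"
      using K1 by (intro power_increasing) auto
    then have "K ^ card (S n) * real n powr \<eta> \<le> K ^ Q * real n powr \<eta>"
      by (intro mult_right_mono) auto
    with main[OF n] show "real (card {d. d dvd n}) \<le> K ^ Q * real n powr \<eta>" by linarith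
  qed
qed

lemma card_int_divisors_le:
  fixes W :: int
  assumes "W \<noteq> 0"
  shows "finite {x. x dvd W}" "card {x. x dvd W} \<le> 2 * card {d. d dvd nat \<bar>W\<bar>}"
proof -
  let ?D = "{d. d dvd nat \<bar>W\<bar>}"
  have fin: "finite ?D"
    using assms by (intro finite_divisors_nat) simp
  have sub: "{x. x dvd W} \<subseteq> int ` ?D \<union> (\<lambda>d. - int d) ` ?D"
  proof
    fix x assume "x \<in> {x. x dvd W}"
    then have "nat \<bar>x\<bar> \<in> ?D"
      by (simp add: nat_dvd_iff)
    moreover have "x = int (nat \<bar>x\<bar>) \<or> x = - int (nat \<bar>x\<bar>)" by linarith
    ultimately show "x \<in> int ` ?D \<union> (\<lambda>d. - int d) ` ?D" by blast
  qed
  then show "finite {x. x dvd W}"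
    by (rule finite_subset) (use fin in auto)
  have "card {x. x dvd W} \<le> card (int ` ?D \<union> (\<lambda>d. - int d) ` ?D)"
    using fin by (intro card_mono sub) auto
  also have "\<dots> \<le> card (int ` ?D) + card ((\<lambda>d. - int d) ` ?D)"
    by (rule card_Un_le)
  also have "\<dots> \<le> card ?D + card ?D"
    using fin by (intro add_mono card_image_le)
  finally show "card {x. x dvd W} \<le> 2 * card ?D" by simp
qed

text \<open>The difference \<open>P(y + e) - P(y)\<close> is not constant in \<open>y\<close> once
  the degree is at least two, so each value has few preimages. For linear \<open>P\<close> it would
  be constant: this is where the degree hypothesis enters the proof.\<close>

lemma card_poly_shift_diff_eq_le:
  fixes P :: "int poly" and e v :: int
  assumes "degree P \<ge> 2" "e \<noteq> 0"
  shows "finite {y. poly P (y + e) - poly P y = v}"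
    and "card {y. poly P (y + e) - poly P y = v} \<le> degree P"
proof -
  define q where "q = pcompose P [:e, 1:] - P - [:v:]"
  have q: "poly q y = poly P (y + e) - poly P y - v" for y
    by (simp add: q_def poly_pcompose add.commute)
  then have eq: "{y. poly P (y + e) - poly P y = v} = {y. poly q y = 0}"
    by auto
  have "q \<noteq> 0"
  proof
    assume "q = 0"
    then have step: "poly P (y + e) = poly P y + v" for y
      using q[of y] by simp
    \<comment> \<open>\<open>P\<close> would be linear along the progression of multiples of \<open>e\<close>.\<close>
    have lin: "poly P (int k * e) = poly P 0 + int k * v" for k
    proof (induction k)
      case (Suc k)
      then show ?case using step[of "int k * e"] by (simp add: algebra_simps)
    qed simp
    \<comment> \<open>Since \<open>e \<noteq> 0\<close>, substituting \<open>e * x\<close> preserves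
      the degree of \<open>P\<close>, so agreement with an affine polynomial at all naturals
      contradicts \<open>degree P \<ge> 2\<close>.\<close>
    define r where "r = pcompose P [:0, e:] - [:poly P 0, v:]"
    have "range int \<subseteq> {x. poly r x = 0}"
      using lin by (auto simp: r_def poly_pcompose mult.commute)
    moreover have "infinite (range int)"
      by (simp add: finite_image_iff)
    ultimately have "r = 0"
      using poly_roots_finite[of r] finite_subset by blast
    then have "pcompose P [:0, e:] = [:poly P 0, v:]"
      by (simp add: r_def)
    then have "degree (pcompose P [:0, e:]) \<le> 1"
      by simp
    then show False
      using assms by (simp add: degree_pcompose)
  qed
  then show "finite {y. poly P (y + e) - poly P y = v}"
    unfolding eq by (rule poly_roots_finite)
  have "card {y. poly q y = 0} \<le> degree q"
    using \<open>q \<noteq> 0\<close> by (rule card_poly_roots_bound)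
  also have "degree q \<le> degree P"
    unfolding q_def by (intro degree_diff_le) (auto simp: degree_pcompose)
  finally show "card {y. poly P (y + e) - poly P y = v} \<le> degree P"
    unfolding eq .
qed

section \<open>Discrepancy and Koksma's inequality\<close>

lemma count_in_le: "count_in x N a b \<le> N"
proof -
  have "card {n \<in> {1..N}. x n \<in> {a..<b}} \<le> card {1..N}"
    by (intro card_mono) auto
  then show ?thesis by (simp add: count_in_def)
qed

lemma count_in_diff_le_discrepancy:
  assumes "0 \<le> a" "a < b" "b \<le> 1"
  shows "\<bar>real (count_in x N a b) - real N * (b - a)\<bar> \<le> real N * discrepancy x N"
proof (cases "N = 0")
  case True
  then show ?thesis using count_in_le[of x 0 a b] by simp
next
  case False
  let ?A = "{(a, b). 0 \<le> a \<and> a < b \<and> b \<le> (1::real)}"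
  let ?f = "\<lambda>(a, b). \<bar>real (count_in x N a b) / real N - (b - a)\<bar>"
  \<comment> \<open>A real \<open>SUP\<close> dominates its members only if the family is bounded
    above. Here each member is the distance between two numbers in the unit interval.\<close>
  have "bdd_above (?f ` ?A)"
  proof (rule bdd_aboveI2)
    fix z assume "z \<in> ?A"
    then obtain a b where z: "z = (a, b)" "0 \<le> a" "a < b" "b \<le> (1::real)" by auto
    have "real (count_in x N a b) / real N \<le> 1"
      using count_in_le[of x N a b] False by simp
    moreover have "real (count_in x N a b) / real N \<ge> 0" by simp
    ultimately show "?f z \<le> 1"
      using z by (simp only: prod.case abs_le_iff) linarith
  qed
  then have "?f (a, b) \<le> discrepancy x N"
    unfolding discrepancy_def using assms by (intro cSUP_upper) auto
  then have "real N * \<bar>real (count_in x N a b) / real N - (b - a)\<bar> \<le> real N * discrepancy x N"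
    by (intro mult_left_mono) auto
  also have "real N * \<bar>real (count_in x N a b) / real N - (b - a)\<bar>
      = \<bar>real N * (real (count_in x N a b) / real N - (b - a))\<bar>"
    by (simp add: abs_mult)
  also have "real N * (real (count_in x N a b) / real N - (b - a))
      = real (count_in x N a b) - real N * (b - a)"
    using False by (simp add: field_simps)
  finally show ?thesis .
qed

text \<open>Koksma's inequality, from
  \<open>\<Sum>F(x\<^sub>n) - N \<integral>F = - \<integral> (A\<^sub>N([0,t)) - N t) F'(t) dt\<close>.\<close>

lemma koksma_inequality:
  fixes F F' :: "real \<Rightarrow> real"
  assumes x: "\<And>n. 0 \<le> x n \<and> x n < 1"
    and F: "\<And>t. (F has_real_derivative F' t) (at t)"
    and L: "\<And>t. \<bar>F' t\<bar> \<le> L"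
    and F0: "(F has_integral 0) {0..1}"
  shows "\<bar>\<Sum>n=1..N. F (x n)\<bar> \<le> L * (real N * discrepancy x N)"
proof -
  \<comment> \<open>The strict condition \<open>x n < t\<close> matches the half-open interval from
    0 to \<open>t\<close>; it differs from \<open>t \<in> {x n..1}\<close> only at the null set
    \<open>{x n}\<close>.\<close>
  have tail: "((\<lambda>t. if x n < t then F' t else 0) has_integral (F 1 - F (x n))) {0..1}" for n
  proof -
    have "(F' has_integral (F 1 - F (x n))) {x n..1}"
      using x[of n] F by (intro fundamental_theorem_of_calculus)
        (auto simp: has_real_derivative_iff_has_vector_derivative intro: has_vector_derivative_at_within)
    then have "((\<lambda>t. if t \<in> {x n..1} then F' t else 0) has_integral (F 1 - F (x n))) {0..1}"
      using x[of n] by (subst has_integral_restrict) auto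
    then show ?thesis
      by (rule has_integral_spike[rotated 2, where S = "{x n}"]) auto
  qed
  have count: "(\<Sum>n=1..N. if x n < t then F' t else 0) = real (count_in x N 0 t) * F' t" for t
  proof -
    have "{n \<in> {1..N}. x n \<in> {0..<t}} = {1..N} \<inter> {n. x n < t}"
      using x by auto
    then show ?thesis
      by (simp add: sum.If_cases count_in_def)
  qed
  have I1: "((\<lambda>t. real (count_in x N 0 t) * F' t) has_integral (\<Sum>n=1..N. F 1 - F (x n))) {0..1}"
    unfolding count[symmetric] by (intro has_integral_sum tail) auto
  \<comment> \<open>Integration by parts: as \<open>F\<close> has mean zero, \<open>t * F' t\<close>
    integrates to \<open>F 1\<close>, and the terms \<open>N * F 1\<close> cancel in
    \<open>I2\<close>.\<close>
  have "((\<lambda>t. t * F' t + F t) has_integral (1 * F 1 - 0 * F 0)) {0..1}"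
  proof (rule fundamental_theorem_of_calculus)
    fix t :: real
    have "((\<lambda>t. t * F t) has_real_derivative (t * F' t + F t)) (at t)"
      using F[of t] by (auto intro!: derivative_eq_intros)
    then show "((\<lambda>t. t * F t) has_vector_derivative (t * F' t + F t)) (at t within {0..1})"
      by (simp add: has_real_derivative_iff_has_vector_derivative has_vector_derivative_at_within)
  qed simp
  from has_integral_diff[OF this F0] have "((\<lambda>t. t * F' t) has_integral F 1) {0..1}"
    by simp
  from has_integral_diff[OF I1 has_integral_mult_right[OF this, of "real N"]]
  have I2: "((\<lambda>t. (real (count_in x N 0 t) - real N * t) * F' t) has_integral - (\<Sum>n=1..N. F (x n))) (cbox 0 1)"
    by (simp add: algebra_simps sum_subtractf)
  have D0: "0 \<le> real N * discrepancy x N"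
    using count_in_diff_le_discrepancy[of 0 1 x N] by linarith
  have L0: "0 \<le> L" using L[of 0] by linarith
  have "norm (- (\<Sum>n=1..N. F (x n))) \<le> (real N * discrepancy x N * L) * measure lborel (cbox (0::real) 1)"
  proof (rule has_integral_bound[OF _ I2])
    show "0 \<le> real N * discrepancy x N * L" using D0 L0 by (rule mult_nonneg_nonneg)
    fix t :: real assume t: "t \<in> cbox 0 1"
    have "\<bar>real (count_in x N 0 t) - real N * t\<bar> \<le> real N * discrepancy x N"
    \<comment> \<open>For \<open>t = 0\<close> the interval is empty and is not among those in the
      supremum, which requires \<open>a < b\<close>; its count is 0.\<close>
    proof (cases "t = 0")
      case True
      then show ?thesis using D0 by (simp add: count_in_def)
    next
      case False
      then show ?thesis
        using t count_in_diff_le_discrepancy[of 0 t x N] by simp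
    qed
    then show "norm ((real (count_in x N 0 t) - real N * t) * F' t) \<le> real N * discrepancy x N * L"
      unfolding real_norm_def abs_mult using L[of t] D0 by (intro mult_mono) auto
  qed
  then show ?thesis by (simp add: mult_ac)
qed

lemma has_integral_cos_period:
  fixes c :: int and j \<phi> :: real
  assumes "c \<noteq> 0"
  shows "((\<lambda>t. cos (2 * pi * real_of_int c * t + \<phi>)) has_integral 0) {j..j+1}"
proof -
  let ?G = "\<lambda>t. sin (2 * pi * real_of_int c * t + \<phi>) / (2 * pi * real_of_int c)"
  have "((\<lambda>t. cos (2 * pi * real_of_int c * t + \<phi>)) has_integral (?G (j + 1) - ?G j)) {j..j+1}"
  proof (rule fundamental_theorem_of_calculus)
    fix t :: real
    have "(?G has_real_derivative cos (2 * pi * real_of_int c * t + \<phi>)) (at t)"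
      using assms by (auto intro!: derivative_eq_intros)
    then show "(?G has_vector_derivative cos (2 * pi * real_of_int c * t + \<phi>)) (at t within {j..j+1})"
      by (simp add: has_real_derivative_iff_has_vector_derivative has_vector_derivative_at_within)
  qed simp
  moreover have "sin (2 * pi * real_of_int c * (j + 1) + \<phi>) = sin (2 * pi * real_of_int c * j + \<phi>)"
  proof -
    have "2 * pi * real_of_int c * (j + 1) + \<phi> = (2 * pi * real_of_int c * j + \<phi>) + 2 * pi * real_of_int c"
      by (simp add: algebra_simps)
    then show ?thesis
      by (simp only: sin_add) simp
  qed
  ultimately show ?thesis by simp
qed

text \<open>The phase \<open>\<phi>\<close> allows real and imaginary parts of an exponential sum to
  be treated alike. The factor \<open>h\<close> comes from the derivative and is affordable because
  later \<open>h\<close> is at most about \<open>N powr \<delta>\<close>.\<close>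

lemma koksma_cos:
  fixes y :: "nat \<Rightarrow> real" and h :: nat and \<phi> :: real
  assumes "h > 0"
  shows "\<bar>\<Sum>n=1..N. cos (2 * pi * real h * y n + \<phi>)\<bar>
    \<le> 2 * pi * real h * (real N * discrepancy (\<lambda>n. frac (y n)) N)"
proof -
  \<comment> \<open>As \<open>h\<close> is an integer, passing to the fractional part moves the
    argument by an integer multiple of \<open>2 * pi\<close>.\<close>
  have shift: "cos (2 * pi * real h * y + \<phi>) = cos (2 * pi * real h * frac y + \<phi>)" for y
  proof -
    have "2 * pi * real h * y + \<phi> = (2 * pi * real h * frac y + \<phi>) + 2 * pi * real_of_int (int h * \<lfloor>y\<rfloor>)"
      by (simp add: frac_def algebra_simps)
    then show ?thesis
      by (simp only: cos_add) (simp only: sin_int_2pin cos_int_2pin, simp)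
  qed
  have "\<bar>\<Sum>n=1..N. cos (2 * pi * real h * frac (y n) + \<phi>)\<bar>
      \<le> 2 * pi * real h * (real N * discrepancy (\<lambda>n. frac (y n)) N)"
  proof (rule koksma_inequality[where F' = "\<lambda>t. - sin (2 * pi * real h * t + \<phi>) * (2 * pi * real h)"])
    show "0 \<le> frac (y n) \<and> frac (y n) < 1" for n
      by (simp add: frac_lt_1)
    show "((\<lambda>t. cos (2 * pi * real h * t + \<phi>)) has_real_derivative
        - sin (2 * pi * real h * t + \<phi>) * (2 * pi * real h)) (at t)" for t
      by (auto intro!: derivative_eq_intros)
    show "\<bar>- sin (2 * pi * real h * t + \<phi>) * (2 * pi * real h)\<bar> \<le> 2 * pi * real h" for t
      using mult_right_mono[OF abs_sin_le_one[of "2 * pi * real h * t + \<phi>"], of "2 * pi * real h"]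
      by (simp add: abs_mult)
    show "((\<lambda>t. cos (2 * pi * real h * t + \<phi>)) has_integral 0) {0..1}"
      using has_integral_cos_period[of "int h" \<phi> 0] assms by simp
  qed
  then show ?thesis by (simp only: shift[of "y n" for n])
qed

section \<open>Second moments of cosine sums and collisions of frequencies\<close>

lemma integral_cos_mult_cos_le:
  fixes u v :: int and j :: real
  shows "integral {j..j+1} (\<lambda>t. cos (2 * pi * real_of_int u * t) * cos (2 * pi * real_of_int v * t))
    \<le> (if \<bar>u\<bar> = \<bar>v\<bar> then 1 else 0)"
proof (cases "\<bar>u\<bar> = \<bar>v\<bar>")
  case True
  have "integral {j..j+1} (\<lambda>t. cos (2 * pi * real_of_int u * t) * cos (2 * pi * real_of_int v * t))
      \<le> integral {j..j+1} (\<lambda>t. 1)"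
  proof (rule integral_le)
    show "(\<lambda>t. cos (2 * pi * real_of_int u * t) * cos (2 * pi * real_of_int v * t)) integrable_on {j..j+1}"
      by (intro integrable_continuous_real continuous_intros)
    fix t :: real
    have "\<bar>cos (2 * pi * real_of_int u * t) * cos (2 * pi * real_of_int v * t)\<bar> \<le> 1 * 1"
      unfolding abs_mult by (intro mult_mono) auto
    then show "cos (2 * pi * real_of_int u * t) * cos (2 * pi * real_of_int v * t) \<le> 1" by linarith
  qed auto
  then show ?thesis using True by simp
next
  case False
  \<comment> \<open>The product-to-sum formula produces the frequencies \<open>u - v\<close> and
    \<open>u + v\<close>. Both are nonzero exactly when the absolute values differ, so each cosine
    integrates to zero over a period.\<close>
  then have "u - v \<noteq> 0" "u + v \<noteq> 0" by auto
  then have "((\<lambda>t. (cos (2 * pi * real_of_int (u - v) * t + 0) + cos (2 * pi * real_of_int (u + v) * t + 0)) / 2)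
      has_integral (0 + 0) / 2) {j..j+1}"
    by (intro has_integral_divide has_integral_add has_integral_cos_period)
  moreover have "(cos (2 * pi * real_of_int (u - v) * t + 0) + cos (2 * pi * real_of_int (u + v) * t + 0)) / 2
      = cos (2 * pi * real_of_int u * t) * cos (2 * pi * real_of_int v * t)" for t
    by (simp add: cos_times_cos algebra_simps)
  ultimately show ?thesis using False by (simp add: integral_unique)
qed

lemma diff_dvd_poly_diff:
  fixes p :: "'a::comm_ring_1 poly"
  shows "x - y dvd poly p x - poly p y"
proof (induction p)
  case (pCons c p)
  have "poly (pCons c p) x - poly (pCons c p) y = x * (poly p x - poly p y) + (x - y) * poly p y"
    by (simp add: algebra_simps)
  then show ?case
    using pCons.IH by (metis dvd_add dvd_mult dvd_triv_left)
qed simp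

text \<open>A solution is encoded by \<open>g\<close> as a triple \<open>(h, v, e)\<close> of
  divisors of \<open>W\<close>, with \<open>v\<close> the difference of the polynomial values and
  \<open>e\<close> that of the arguments, together with \<open>m b\<close>. The last entry solves
  \<open>P(y + e) - P(y) = v\<close>, which leaves at most \<open>degree P\<close> choices per
  triple.\<close>

lemma card_collisions_le:
  fixes P :: "int poly" and m :: "nat \<Rightarrow> int" and W :: int
  assumes P: "degree P \<ge> 2" and m: "inj_on m {1..}" and W: "W \<noteq> 0"
  shows "card {(h, a, b) \<in> {1..H} \<times> {1..N} \<times> {1..N}.
      \<bar>int h * (poly P (m a) - poly P (m b))\<bar> = \<bar>W\<bar>} \<le> degree P * card {x. x dvd W} ^ 3"
proof -
  let ?J = "{(h, a, b) \<in> {1..H} \<times> {1..N} \<times> {1..N}. \<bar>int h * (poly P (m a) - poly P (m b))\<bar> = \<bar>W\<bar>}"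
  define D where "D = {x. x dvd W}"
  define E where "E = {(h, v, e) \<in> D \<times> D \<times> D. e \<noteq> 0}"
  define R where "R = (\<lambda>(h :: int, v, e). {y. poly P (y + e) - poly P y = v})"
  define g where "g = (\<lambda>(h, a, b). ((int h, poly P (m a) - poly P (m b), m a - m b), m b))"
  have finD: "finite D"
    unfolding D_def using W by (rule card_int_divisors_le)
  have finE: "finite E"
    by (rule finite_subset[of _ "D \<times> D \<times> D"]) (use finD in \<open>auto simp: E_def\<close>)
  have R: "finite (R z)" "card (R z) \<le> degree P" if "z \<in> E" for z
    using that card_poly_shift_diff_eq_le[OF P] by (auto simp: E_def R_def)
  \<comment> \<open>The code determines \<open>m b\<close> and \<open>m a\<close>, hence
    \<open>b\<close> and \<open>a\<close> by injectivity of \<open>m\<close> on positive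
    indices.\<close>
  have "inj_on g ?J"
  proof (rule inj_onI)
    fix i i' assume "i \<in> ?J" "i' \<in> ?J" "g i = g i'"
    then obtain h a b h' a' b' where "i = (h, a, b)" "i' = (h', a', b')"
      and "a \<ge> 1" "b \<ge> 1" "a' \<ge> 1" "b' \<ge> 1" "h = h'" "m b = m b'" "m a = m a'"
      by (auto simp: g_def)
    then show "i = i'"
      using m by (auto simp: inj_on_def)
  qed
  moreover have "g ` ?J \<subseteq> Sigma E R"
  proof
    fix z assume "z \<in> g ` ?J"
    then obtain h a b where z: "z = ((int h, poly P (m a) - poly P (m b), m a - m b), m b)"
      and eq: "\<bar>int h * (poly P (m a) - poly P (m b))\<bar> = \<bar>W\<bar>"
      by (auto simp: g_def)
    let ?v = "poly P (m a) - poly P (m b)"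
    have hv: "int h * ?v dvd W"
      using eq by (metis dvd_refl abs_dvd_iff dvd_abs_iff)
    have "m a - m b dvd ?v"
      by (rule diff_dvd_poly_diff)
    moreover have "int h dvd W" "?v dvd W"
      using hv by (auto intro: dvd_mult_left dvd_mult_right)
    moreover have "m a - m b \<noteq> 0"
      using eq W by auto
    ultimately show "z \<in> Sigma E R"
      by (auto simp: z E_def R_def D_def intro: dvd_trans)
  qed
  moreover have finS: "finite (Sigma E R)"
    using finE R by (intro finite_SigmaI) auto
  ultimately have "card ?J \<le> card (Sigma E R)"
    by (meson card_inj_on_le)
  also have "\<dots> = (\<Sum>z\<in>E. card (R z))"
    using finE R by (intro card_SigmaI) auto
  also have "\<dots> \<le> (\<Sum>z\<in>E. degree P)"
    by (intro sum_mono R)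
  also have "\<dots> = card E * degree P" by simp
  also have "card E \<le> card (D \<times> D \<times> D)"
    using finD by (intro card_mono) (auto simp: E_def)
  also have "\<dots> = card D ^ 3"
    by (simp add: card_cartesian_product power3_eq_cube)
  finally show ?thesis by (simp add: D_def mult.commute)
qed

text \<open>After expanding the square, only pairs with frequencies equal up to sign survive.
  Grouping these pairs by their first index lets the collision bound be applied to one value
  \<open>w i\<close> at a time.\<close>

lemma integral_cos_sum_square_le:
  fixes w :: "'i \<Rightarrow> int" and j :: real
  assumes "finite I"
  shows "integral {j..j+1} (\<lambda>t. (\<Sum>i\<in>I. cos (2 * pi * real_of_int (w i) * t))\<^sup>2)
    \<le> (\<Sum>i\<in>I. real (card {i'\<in>I. \<bar>w i'\<bar> = \<bar>w i\<bar>}))"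
proof -
  let ?c = "\<lambda>i t. cos (2 * pi * real_of_int (w i) * t)"
  have int: "(\<lambda>t. ?c i t * ?c i' t) integrable_on {j..j+1}" for i i'
    by (intro integrable_continuous_real continuous_intros)
  have "integral {j..j+1} (\<lambda>t. (\<Sum>i\<in>I. ?c i t)\<^sup>2)
      = integral {j..j+1} (\<lambda>t. \<Sum>i\<in>I. \<Sum>i'\<in>I. ?c i t * ?c i' t)"
    by (simp add: power2_eq_square sum_product)
  also have "\<dots> = (\<Sum>i\<in>I. \<Sum>i'\<in>I. integral {j..j+1} (\<lambda>t. ?c i t * ?c i' t))"
    using assms by (simp add: integral_sum int integrable_sum)
  also have "\<dots> \<le> (\<Sum>i\<in>I. \<Sum>i'\<in>I. if \<bar>w i\<bar> = \<bar>w i'\<bar> then 1 else 0)"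
    by (intro sum_mono integral_cos_mult_cos_le)
  also have "\<dots> = (\<Sum>i\<in>I. real (card {i'\<in>I. \<bar>w i'\<bar> = \<bar>w i\<bar>}))"
  proof (rule sum.cong[OF refl])
    fix i
    have "I \<inter> {i'. \<bar>w i\<bar> = \<bar>w i'\<bar>} = {i'\<in>I. \<bar>w i'\<bar> = \<bar>w i\<bar>}" by auto
    then show "(\<Sum>i'\<in>I. if \<bar>w i\<bar> = \<bar>w i'\<bar> then 1 else 0) = real (card {i'\<in>I. \<bar>w i'\<bar> = \<bar>w i\<bar>})"
      using assms by (simp add: sum.If_cases)
  qed
  finally show ?thesis .
qed

text \<open>Chebyshev's inequality on a unit interval; measurability and finite measure are recorded
  for Borel--Cantelli.\<close>

lemma measure_cos_sum_large_le:
  fixes w :: "'i \<Rightarrow> int" and j c :: real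
  assumes "finite I" "c > 0"
  defines "A \<equiv> {t \<in> {j..j+1}. c \<le> (\<Sum>i\<in>I. cos (2 * pi * real_of_int (w i) * t))\<^sup>2}"
  shows "A \<in> sets lborel" "emeasure lborel A < \<infinity>"
    and "measure lborel A \<le> (\<Sum>i\<in>I. real (card {i'\<in>I. \<bar>w i'\<bar> = \<bar>w i\<bar>})) / c"
proof -
  let ?T = "\<lambda>t. (\<Sum>i\<in>I. cos (2 * pi * real_of_int (w i) * t))\<^sup>2"
  let ?u = "\<lambda>t. indicator {j..j+1} t *\<^sub>R ?T t"
  show meas: "A \<in> sets lborel"
    unfolding A_def by measurable
  have "emeasure lborel A \<le> emeasure lborel {j..j+1}"
    by (intro emeasure_mono) (auto simp: A_def)
  also have "\<dots> < \<infinity>" by simp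
  finally show "emeasure lborel A < \<infinity>" .
  have si: "set_integrable lborel {j..j+1} ?T"
    by (intro borel_integrable_atLeastAtMost' continuous_intros)
  \<comment> \<open>Cutting off by the indicator moves the problem to all of \<open>lborel\<close>;
    \<open>c > 0\<close> keeps points outside the interval out of the level set.\<close>
  have "A = {t \<in> space lborel. ?u t \<ge> c}"
    using assms(2) by (auto simp: A_def indicator_def split: if_splits)
  also have "measure lborel \<dots> \<le> (\<integral>t. ?u t \<partial>lborel) / c"
    using si assms(2) meas by (intro integral_Markov_inequality_measure[of _ _ A]) (auto simp: set_integrable_def)
  also have "(\<integral>t. ?u t \<partial>lborel) = integral {j..j+1} ?T"
    using set_borel_integral_eq_integral(2)[OF si] by (simp add: set_lebesgue_integral_def)
  also have "integral {j..j+1} ?T / c \<le> (\<Sum>i\<in>I. real (card {i'\<in>I. \<bar>w i'\<bar> = \<bar>w i\<bar>})) / c"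
    using assms by (intro divide_right_mono integral_cos_sum_square_le) auto
  finally show "measure lborel A \<le> (\<Sum>i\<in>I. real (card {i'\<in>I. \<bar>w i'\<bar> = \<bar>w i\<bar>})) / c" .
qed

section \<open>From collision counts to large exponential sums\<close>

lemma poly_values_polynomial_growth:
  fixes P :: "int poly" and m :: "nat \<Rightarrow> int"
  assumes "\<exists>n0. \<forall>n\<ge>n0. real_of_int \<bar>m n\<bar> \<le> real n ^ t"
  obtains K :: real and s :: nat where "K > 0"
    "\<And>n N. 1 \<le> n \<Longrightarrow> n \<le> N \<Longrightarrow> real_of_int \<bar>poly P (m n)\<bar> \<le> K * real N ^ s"
proof -
  obtain n0 where n0: "\<And>n. n \<ge> n0 \<Longrightarrow> real_of_int \<bar>m n\<bar> \<le> real n ^ t"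
    using assms by blast
  \<comment> \<open>\<open>B\<close> dominates the finitely many \<open>m n\<close> with
    \<open>n < n0\<close>, about which the growth hypothesis says nothing.\<close>
  define B where "B = 1 + (\<Sum>n<n0. real_of_int \<bar>m n\<bar>)"
  define K where "K = 1 + (\<Sum>i\<le>degree P. real_of_int \<bar>coeff P i\<bar>)"
  have B: "B \<ge> 1" by (simp add: B_def sum_nonneg)
  have K: "K \<ge> 1" by (simp add: K_def sum_nonneg)
  show ?thesis
  proof (rule that[of "K * B ^ degree P" "t * degree P"])
    show "K * B ^ degree P > 0" using B K by simp
    fix n N :: nat assume nN: "1 \<le> n" "n \<le> N"
    define X where "X = B * real N ^ t"
    have N1: "real N ^ t \<ge> 1" using nN by (intro one_le_power) auto
    have X1: "X \<ge> 1"
      unfolding X_def using mult_mono[OF B N1] B by simp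
    have mX: "real_of_int \<bar>m n\<bar> \<le> X"
    proof (cases "n < n0")
      case True
      then have "real_of_int \<bar>m n\<bar> \<le> (\<Sum>n<n0. real_of_int \<bar>m n\<bar>)"
        by (intro member_le_sum) auto
      then have "real_of_int \<bar>m n\<bar> \<le> B * 1" by (simp add: B_def)
      also have "\<dots> \<le> X" unfolding X_def using N1 B by (intro mult_left_mono) auto
      finally show ?thesis .
    next
      case False
      then have "real_of_int \<bar>m n\<bar> \<le> real n ^ t" using n0 by simp
      also have "\<dots> \<le> 1 * real N ^ t" using nN by (simp add: power_mono)
      also have "\<dots> \<le> X" unfolding X_def using B by (intro mult_right_mono) auto
      finally show ?thesis .
    qed
    have "real_of_int \<bar>poly P (m n)\<bar> \<le> real_of_int (\<Sum>i\<le>degree P. \<bar>coeff P i * m n ^ i\<bar>)"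
      unfolding poly_altdef of_int_le_iff by (rule sum_abs)
    also have "\<dots> = (\<Sum>i\<le>degree P. real_of_int \<bar>coeff P i\<bar> * real_of_int \<bar>m n\<bar> ^ i)"
      by (simp add: abs_mult power_abs)
    also have "\<dots> \<le> (\<Sum>i\<le>degree P. real_of_int \<bar>coeff P i\<bar> * X ^ degree P)"
    proof (intro sum_mono mult_left_mono)
      fix i assume "i \<in> {..degree P}"
      have "real_of_int \<bar>m n\<bar> ^ i \<le> X ^ i" using mX by (intro power_mono) auto
      also have "\<dots> \<le> X ^ degree P"
        using X1 \<open>i \<in> _\<close> by (intro power_increasing) auto
      finally show "real_of_int \<bar>m n\<bar> ^ i \<le> X ^ degree P" .
    qed auto
    also have "\<dots> = (\<Sum>i\<le>degree P. real_of_int \<bar>coeff P i\<bar>) * X ^ degree P"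
      by (simp add: sum_distrib_right)
    also have "\<dots> \<le> K * X ^ degree P"
      using X1 by (intro mult_right_mono) (auto simp: K_def)
    also have "\<dots> = K * B ^ degree P * real N ^ (t * degree P)"
      by (simp add: X_def power_mult_distrib power_mult)
    finally show "real_of_int \<bar>poly P (m n)\<bar> \<le> K * B ^ degree P * real N ^ (t * degree P)" .
  qed
qed

lemma sum_collisions_le:
  fixes P :: "int poly" and m :: "nat \<Rightarrow> int" and \<delta> :: real
  assumes P: "degree P \<ge> 2" and m: "inj_on m {1..}"
    and growth: "\<exists>n0. \<forall>n\<ge>n0. real_of_int \<bar>m n\<bar> \<le> real n ^ t"
    and \<delta>: "\<delta> > 0"
  defines "w \<equiv> \<lambda>(h, a, b). int h * (poly P (m a) - poly P (m b))"
  obtains M where "M > 0"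
    "\<And>H N. N \<ge> 1 \<Longrightarrow> H \<le> 2 * N \<Longrightarrow>
      (let I = {i \<in> {1..H} \<times> {1..N} \<times> {1..N}. w i \<noteq> 0} in
        (\<Sum>i\<in>I. real (card {i'\<in>I. \<bar>w i'\<bar> = \<bar>w i\<bar>})) \<le> M * real N powr \<delta> * real H * (real N)\<^sup>2)"
proof -
  obtain K :: real and s :: nat where K: "K > 0"
    and Kb: "\<And>n N. 1 \<le> n \<Longrightarrow> n \<le> N \<Longrightarrow> real_of_int \<bar>poly P (m n)\<bar> \<le> K * real N ^ s"
    using poly_values_polynomial_growth[OF growth] by metis
  \<comment> \<open>The frequencies are at most \<open>4 * K * N ^ Suc s\<close>, and the divisor
    count enters cubed, so this exponent adds up to exactly \<open>\<delta>\<close>.\<close>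
  define \<eta> where "\<eta> = \<delta> / (3 * real (Suc s))"
  have \<eta>: "\<eta> > 0" using \<delta> by (simp add: \<eta>_def)
  obtain C where C: "C > 0"
    and Cb: "\<And>n::nat. n > 0 \<Longrightarrow> real (card {d. d dvd n}) \<le> C * real n powr \<eta>"
    using card_divisors_le_powr[OF \<eta>] by metis
  \<comment> \<open>The factor 2 counts signs of divisors. The 4 is a 2 from
    \<open>H \<le> 2 * N\<close> times a 2 from the difference of two polynomial values.\<close>
  define M where "M = real (degree P) * (2 * C * (4 * K) powr \<eta>) ^ 3"
  show ?thesis
  proof (rule that[of M])
    show "M > 0" using P C K by (simp add: M_def)
    fix H N :: nat assume N: "N \<ge> 1" and H: "H \<le> 2 * N"
    define I where "I = {i \<in> {1..H} \<times> {1..N} \<times> {1..N}. w i \<noteq> 0}"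
    have "card I \<le> card ({1..H} \<times> {1..N} \<times> {1..N})"
      unfolding I_def by (intro card_mono) auto
    then have cardI: "real (card I) \<le> real H * (real N)\<^sup>2"
      by (simp add: card_cartesian_product power2_eq_square flip: of_nat_mult)
    have card_le: "real (card {i'\<in>I. \<bar>w i'\<bar> = \<bar>w i\<bar>}) \<le> M * real N powr \<delta>" if i: "i \<in> I" for i
    proof -
      obtain h a b where hab: "i = (h, a, b)" "h \<le> H" "1 \<le> a" "a \<le> N" "1 \<le> b" "b \<le> N"
        using i by (auto simp: I_def)
      have W0: "w i \<noteq> 0" using i by (simp add: I_def)
      have "real_of_int \<bar>w i\<bar> = real h * real_of_int \<bar>poly P (m a) - poly P (m b)\<bar>"
        by (simp add: w_def hab abs_mult)
      also have "\<dots> \<le> (2 * real N) * (2 * K * real N ^ s)"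
      proof (intro mult_mono)
        show "real h \<le> 2 * real N" using hab H by linarith
        show "real_of_int \<bar>poly P (m a) - poly P (m b)\<bar> \<le> 2 * K * real N ^ s"
          using Kb[of a N] Kb[of b N] hab by simp
      qed auto
      also have "\<dots> = 4 * K * real N ^ Suc s" by simp
      finally have W: "real_of_int \<bar>w i\<bar> \<le> 4 * K * real N ^ Suc s" .
      have "real (card {x. x dvd w i}) \<le> 2 * real (card {d. d dvd nat \<bar>w i\<bar>})"
        using card_int_divisors_le(2)[OF W0] by linarith
      also have "\<dots> \<le> 2 * (C * real (nat \<bar>w i\<bar>) powr \<eta>)"
        using W0 by (intro mult_left_mono Cb) auto
      also have "real (nat \<bar>w i\<bar>) powr \<eta> \<le> (4 * K * real N ^ Suc s) powr \<eta>"
        using W \<eta> by (intro powr_mono2) auto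
      also have "(4 * K * real N ^ Suc s) powr \<eta> = (4 * K) powr \<eta> * (real N ^ Suc s) powr \<eta>"
        using K by (intro powr_mult)
      also have "(real N ^ Suc s) powr \<eta> = real N powr (\<delta> / 3)"
      proof -
        have "real N ^ Suc s = real N powr real (Suc s)"
          using N by (simp only: powr_realpow)
        moreover have "real (Suc s) * \<eta> = \<delta> / 3"
          by (simp add: \<eta>_def field_simps del: of_nat_Suc)
        ultimately show ?thesis
          by (simp only: powr_powr)
      qed
      finally have D: "real (card {x. x dvd w i}) \<le> (2 * C * (4 * K) powr \<eta>) * real N powr (\<delta> / 3)"
        using C by (simp add: mult_ac)
      have "card {i'\<in>I. \<bar>w i'\<bar> = \<bar>w i\<bar>} \<le> card {(h, a, b) \<in> {1..H} \<times> {1..N} \<times> {1..N}.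
          \<bar>int h * (poly P (m a) - poly P (m b))\<bar> = \<bar>w i\<bar>}"
        by (rule card_mono, rule finite_subset[of _ "{1..H} \<times> {1..N} \<times> {1..N}"])
          (auto simp: I_def w_def)
      also have "\<dots> \<le> degree P * card {x. x dvd w i} ^ 3"
        using P m W0 by (rule card_collisions_le)
      finally have "real (card {i'\<in>I. \<bar>w i'\<bar> = \<bar>w i\<bar>}) \<le> real (degree P * card {x. x dvd w i} ^ 3)"
        by (rule of_nat_mono)
      also have "\<dots> = real (degree P) * real (card {x. x dvd w i}) ^ 3"
        by simp
      also have "\<dots> \<le> real (degree P) * ((2 * C * (4 * K) powr \<eta>) * real N powr (\<delta> / 3)) ^ 3"
        using D by (intro mult_left_mono power_mono) auto
      also have "\<dots> = M * (real N powr (\<delta> / 3)) ^ 3"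
        by (simp add: M_def power_mult_distrib)
      also have "(real N powr (\<delta> / 3)) ^ 3 = real N powr \<delta>"
        by (simp add: power3_eq_cube flip: powr_add)
      finally show ?thesis .
    qed
    have "(\<Sum>i\<in>I. real (card {i'\<in>I. \<bar>w i'\<bar> = \<bar>w i\<bar>})) \<le> (\<Sum>i\<in>I. M * real N powr \<delta>)"
      by (intro sum_mono card_le)
    also have "\<dots> = M * real N powr \<delta> * real (card I)" by simp
    also have "\<dots> \<le> M * real N powr \<delta> * (real H * (real N)\<^sup>2)"
      using cardI \<open>M > 0\<close> by (intro mult_left_mono) auto
    finally show "let I = {i \<in> {1..H} \<times> {1..N} \<times> {1..N}. w i \<noteq> 0} in
        (\<Sum>i\<in>I. real (card {i'\<in>I. \<bar>w i'\<bar> = \<bar>w i\<bar>})) \<le> M * real N powr \<delta> * real H * (real N)\<^sup>2"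
      by (simp add: I_def Let_def mult_ac)
  qed
qed

text \<open>The double sum is the squared modulus of the exponential sum of the dilate
  \<open>h\<close>. Restricting to a unit interval provides the finite measure that the second
  moment needs.\<close>

lemma AE_eventually_dilate_large:
  fixes P :: "int poly" and m :: "nat \<Rightarrow> int" and \<delta> :: real
  assumes P: "degree P \<ge> 2" and m: "inj_on m {1..}"
    and growth: "\<exists>n0. \<forall>n\<ge>n0. real_of_int \<bar>m n\<bar> \<le> real n ^ t"
    and \<delta>: "0 < \<delta>" "\<delta> \<le> 1"
  shows "AE \<alpha> in lborel. \<alpha> \<in> {j..j+1} \<longrightarrow> (\<forall>\<^sub>F k in sequentially.
    \<exists>h\<in>{1..nat \<lceil>real (2 ^ k) powr \<delta>\<rceil>}. real (2 ^ k) / 2 \<le>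
      (\<Sum>a=1..2^k. \<Sum>b=1..2^k. cos (2 * pi * real_of_int (int h * (poly P (m a) - poly P (m b))) * \<alpha>)))"
proof -
  define w where "w = (\<lambda>(h, a, b). int h * (poly P (m a) - poly P (m b)))"
  obtain M where M: "M > 0" and Mb: "\<And>H N. N \<ge> 1 \<Longrightarrow> H \<le> 2 * N \<Longrightarrow>
      (let I = {i \<in> {1..H} \<times> {1..N} \<times> {1..N}. w i \<noteq> 0} in
        (\<Sum>i\<in>I. real (card {i'\<in>I. \<bar>w i'\<bar> = \<bar>w i\<bar>})) \<le> M * real N powr (\<delta> / 2) * real H * (real N)\<^sup>2)"
    by (rule sum_collisions_le[OF P m growth half_gt_zero[OF \<delta>(1)], folded w_def]) (rule that)
  define N :: "nat \<Rightarrow> nat" where "N k = 2 ^ k" for k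
  define H where "H k = nat \<lceil>real (N k) powr \<delta>\<rceil>" for k
  define B where "B k = {1..H k} \<times> {1..N k} \<times> {1..N k}" for k
  define I where "I k = {i \<in> B k. w i \<noteq> 0}" for k
  \<comment> \<open>The indices with \<open>w i = 0\<close> contribute at least
    \<open>H * N\<close>; an exceptional \<open>\<alpha>\<close> is one where the remaining sum
    reaches half of that in absolute value.\<close>
  define c where "c k = (real (H k) * real (N k) / 2)\<^sup>2" for k
  define A where "A k = {\<alpha> \<in> {j..j+1}. c k \<le> (\<Sum>i\<in>I k. cos (2 * pi * real_of_int (w i) * \<alpha>))\<^sup>2}" for k
  have N1: "N k \<ge> 1" for k by (simp add: N_def)
  have Nd: "real (N k) powr \<delta> \<ge> 1" for k
    using N1[of k] \<delta> by (intro ge_one_powr_ge_zero) auto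
  have Hge: "real (H k) \<ge> real (N k) powr \<delta>" for k
    unfolding H_def by linarith
  have H1: "real (H k) \<ge> 1" for k
    using Hge[of k] Nd[of k] by linarith
  have Hle: "H k \<le> 2 * N k" for k
  proof -
    have "real (N k) powr \<delta> \<le> real (N k) powr 1"
      using N1[of k] \<delta> by (intro powr_mono) auto
    then have "real (N k) powr \<delta> \<le> real (N k)" by simp
    then have "H k \<le> N k" unfolding H_def by linarith
    then show ?thesis by simp
  qed
  have c0: "c k > 0" for k
    using H1[of k] N1[of k] by (simp add: c_def)
  have finB: "finite (B k)" for k by (simp add: B_def)
  have finI: "finite (I k)" for k using finB by (simp add: I_def)
  \<comment> \<open>The collision bound was taken with \<open>\<delta> / 2\<close>, while dividing
    by \<open>c k\<close> gains a factor \<open>H k \<ge> N k powr \<delta>\<close>. The surplus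
    \<open>N k powr (- \<delta> / 2)\<close> is geometric in \<open>k\<close>, hence
    summable.\<close>
  have meas_le: "measure lborel (A k) \<le> 4 * M * (2 powr (- \<delta> / 2)) ^ k" for k
  proof -
    have "measure lborel (A k) \<le> (\<Sum>i\<in>I k. real (card {i'\<in>I k. \<bar>w i'\<bar> = \<bar>w i\<bar>})) / c k"
      unfolding A_def using finI c0 by (rule measure_cos_sum_large_le)
    also have "\<dots> \<le> (M * real (N k) powr (\<delta> / 2) * real (H k) * (real (N k))\<^sup>2) / c k"
      using Mb[OF N1[of k] Hle[of k]] c0[of k]
      by (intro divide_right_mono) (auto simp: Let_def I_def B_def)
    also have "\<dots> = 4 * M * (real (N k) powr (\<delta> / 2) / real (H k))"
      using N1[of k] H1[of k] by (simp add: c_def field_simps power2_eq_square)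
    also have "\<dots> \<le> 4 * M * (real (N k) powr (\<delta> / 2) / real (N k) powr \<delta>)"
      using M Hge[of k] Nd[of k] H1[of k] N1[of k]
      by (intro mult_left_mono divide_left_mono mult_pos_pos) auto
    also have "real (N k) powr (\<delta> / 2) / real (N k) powr \<delta> = real (N k) powr (- \<delta> / 2)"
      by (simp flip: powr_diff)
    also have "\<dots> = (2 powr (- \<delta> / 2)) ^ k"
      by (simp add: N_def powr_powr mult.commute flip: powr_realpow)
    finally show ?thesis .
  qed
  have "summable (\<lambda>k. 4 * M * (2 powr (- \<delta> / 2)) ^ k)"
    using \<delta> by (intro summable_mult summable_geometric) (auto simp: powr_less_one)
  then have summ: "summable (\<lambda>k. measure lborel (A k))"
    by (rule summable_comparison_test'[where N = 0]) (use meas_le in simp)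
  have "AE \<alpha> in lborel. \<forall>\<^sub>F k in sequentially. \<alpha> \<in> space lborel - A k"
    using summ by (intro borel_cantelli_AE1)
      (auto simp only: A_def intro!: measure_cos_sum_large_le finI c0)
  then show ?thesis
  proof (eventually_elim, intro impI)
    fix \<alpha> assume ev: "\<forall>\<^sub>F k in sequentially. \<alpha> \<in> space lborel - A k" and \<alpha>: "\<alpha> \<in> {j..j+1}"
    have "\<exists>h\<in>{1..H k}. real (N k) / 2 \<le> (\<Sum>a=1..N k. \<Sum>b=1..N k. cos (2 * pi * real_of_int (w (h, a, b)) * \<alpha>))"
      if k: "\<alpha> \<in> space lborel - A k" for k
    proof (rule ccontr)
      let ?c = "\<lambda>i. cos (2 * pi * real_of_int (w i) * \<alpha>)"
      \<comment> \<open>If every \<open>h\<close> fails, the total over all \<open>h\<close> is at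
        most \<open>H * N / 2\<close>. But zero frequencies give at least \<open>H * N\<close> and
        the others more than \<open>- H * N / 2\<close>, a contradiction.\<close>
      assume "\<not> ?thesis"
      then have "(\<Sum>h=1..H k. \<Sum>a=1..N k. \<Sum>b=1..N k. ?c (h, a, b)) \<le> (\<Sum>h=1..H k. real (N k) / 2)"
        by (intro sum_mono) force
      then have up: "(\<Sum>h=1..H k. \<Sum>a=1..N k. \<Sum>b=1..N k. ?c (h, a, b)) \<le> real (H k) * real (N k) / 2"
        by simp
      have "\<bar>\<Sum>i\<in>I k. ?c i\<bar>\<^sup>2 < (real (H k) * real (N k) / 2)\<^sup>2"
        using k \<alpha> by (auto simp: A_def c_def)
      then have "\<bar>\<Sum>i\<in>I k. ?c i\<bar> < real (H k) * real (N k) / 2"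
        by (rule power2_less_imp_less) simp
      then have low: "- (real (H k) * real (N k) / 2) < (\<Sum>i\<in>I k. ?c i)" by linarith
      have "(\<lambda>(h, a). (h, a, a)) ` ({1..H k} \<times> {1..N k}) \<subseteq> B k - I k"
        by (auto simp: I_def B_def w_def)
      then have "card ((\<lambda>(h, a). (h, a, a)) ` ({1..H k} \<times> {1..N k})) \<le> card (B k - I k)"
        using finB by (intro card_mono) auto
      moreover have "card ((\<lambda>(h, a). (h, a, a)) ` ({1..H k} \<times> {1..N k})) = H k * N k"
        by (subst card_image) (auto simp: inj_on_def card_cartesian_product)
      ultimately have "H k * N k \<le> card (B k - I k)" by simp
      then have "real (H k) * real (N k) \<le> real (card (B k - I k))"
        by (simp flip: of_nat_mult)
      also have "\<dots> = (\<Sum>i\<in>B k - I k. ?c i)"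
        by (simp add: I_def)
      finally have "real (H k) * real (N k) \<le> (\<Sum>i\<in>B k - I k. ?c i)" .
      moreover have "(\<Sum>i\<in>B k. ?c i) = (\<Sum>i\<in>B k - I k. ?c i) + (\<Sum>i\<in>I k. ?c i)"
        using finB by (intro sum.subset_diff) (auto simp: I_def)
      moreover have "(\<Sum>i\<in>B k. ?c i) = (\<Sum>h=1..H k. \<Sum>a=1..N k. \<Sum>b=1..N k. ?c (h, a, b))"
        unfolding B_def by (simp add: sum.cartesian_product split_def)
      ultimately show False using up low by linarith
    qed
    with ev have "\<forall>\<^sub>F k in sequentially.
        \<exists>h\<in>{1..H k}. real (N k) / 2 \<le> (\<Sum>a=1..N k. \<Sum>b=1..N k. cos (2 * pi * real_of_int (w (h, a, b)) * \<alpha>))"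
      by (rule eventually_mono)
    then show "\<forall>\<^sub>F k in sequentially.
      \<exists>h\<in>{1..nat \<lceil>real (2 ^ k) powr \<delta>\<rceil>}. real (2 ^ k) / 2 \<le>
        (\<Sum>a=1..2^k. \<Sum>b=1..2^k. cos (2 * pi * real_of_int (int h * (poly P (m a) - poly P (m b))) * \<alpha>))"
      unfolding H_def N_def w_def prod.case .
  qed
qed

section \<open>From exponential sums to the discrepancy\<close>

lemma discrepancy_ge_of_exponential_sum:
  fixes y :: "nat \<Rightarrow> real" and h N :: nat
  assumes h: "h \<ge> 1"
    and large: "real N / 2 \<le> (\<Sum>a=1..N. \<Sum>b=1..N. cos (2 * pi * real h * y a - 2 * pi * real h * y b))"
  shows "sqrt (real N) / 2 \<le> 2 * pi * real h * (real N * discrepancy (\<lambda>n. frac (y n)) N)"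
proof -
  define \<theta> where "\<theta> a = 2 * pi * real h * y a" for a
  define E where "E = 2 * pi * real h * (real N * discrepancy (\<lambda>n. frac (y n)) N)"
  have C: "\<bar>\<Sum>a=1..N. cos (\<theta> a)\<bar> \<le> E"
    using koksma_cos[of h y 0 N] h by (simp add: E_def \<theta>_def)
  \<comment> \<open>The phase \<open>- (pi / 2)\<close> turns the cosine into a sine, giving the
    imaginary part.\<close>
  have "\<bar>\<Sum>a=1..N. cos (\<theta> a + - (pi / 2))\<bar> \<le> E"
    unfolding E_def \<theta>_def using h by (intro koksma_cos) auto
  moreover have "cos (\<theta> a + - (pi / 2)) = sin (\<theta> a)" for a
    by (simp add: cos_diff)
  ultimately have S: "\<bar>\<Sum>a=1..N. sin (\<theta> a)\<bar> \<le> E" by simp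
  have E0: "E \<ge> 0" using C by linarith
  have "real N / 2 \<le> (\<Sum>a=1..N. \<Sum>b=1..N. cos (\<theta> a - \<theta> b))"
    using large by (simp add: \<theta>_def)
  also have "\<dots> = (\<Sum>a=1..N. cos (\<theta> a))\<^sup>2 + (\<Sum>a=1..N. sin (\<theta> a))\<^sup>2"
    by (simp add: cos_diff sum.distrib power2_eq_square sum_product)
  also have "\<dots> \<le> E\<^sup>2 + E\<^sup>2"
    using C S E0 by (intro add_mono) (auto simp: abs_le_square_iff[symmetric])
  finally have "real N \<le> (2 * E)\<^sup>2"
    by (simp add: power_mult_distrib)
  then have "sqrt (real N) \<le> 2 * E"
    using E0 by (intro real_le_lsqrt) auto
  then show ?thesis by (simp add: E_def)
qed

text \<open>One \<open>\<delta>\<close> in the exponent is lost to the size of \<open>h\<close>, the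
  other absorbs the constant \<open>8 * pi\<close>.\<close>

lemma AE_discrepancy_ge_powr:
  fixes P :: "int poly" and m :: "nat \<Rightarrow> int" and \<delta> :: real
  assumes P: "degree P \<ge> 2" and m: "inj_on m {1..}"
    and growth: "\<exists>n0. \<forall>n\<ge>n0. real_of_int \<bar>m n\<bar> \<le> real n ^ t"
    and \<delta>: "0 < \<delta>" "\<delta> \<le> 1"
  shows "AE \<alpha> in lborel. \<forall>\<^sub>F k in sequentially. real (2 ^ k) powr (1/2 - 2 * \<delta>)
    \<le> real (2 ^ k) * discrepancy (\<lambda>n. frac (real_of_int (poly P (m n)) * \<alpha>)) (2 ^ k)"
proof -
  \<comment> \<open>Countably many unit intervals cover the line, so the exceptional null sets can
    be united.\<close>
  have "AE \<alpha> in lborel. \<forall>j::int. \<alpha> \<in> {real_of_int j..real_of_int j+1} \<longrightarrow> (\<forall>\<^sub>F k in sequentially.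
    \<exists>h\<in>{1..nat \<lceil>real (2 ^ k) powr \<delta>\<rceil>}. real (2 ^ k) / 2 \<le>
      (\<Sum>a=1..2^k. \<Sum>b=1..2^k. cos (2 * pi * real_of_int (int h * (poly P (m a) - poly P (m b))) * \<alpha>)))"
    unfolding AE_all_countable by (intro allI AE_eventually_dilate_large[OF P m growth \<delta>])
  then show ?thesis
  proof eventually_elim
    fix \<alpha> :: real
    let ?y = "\<lambda>n. real_of_int (poly P (m n)) * \<alpha>"
    assume all: "\<forall>j::int. \<alpha> \<in> {real_of_int j..real_of_int j+1} \<longrightarrow> (\<forall>\<^sub>F k in sequentially.
      \<exists>h\<in>{1..nat \<lceil>real (2 ^ k) powr \<delta>\<rceil>}. real (2 ^ k) / 2 \<le>
        (\<Sum>a=1..2^k. \<Sum>b=1..2^k. cos (2 * pi * real_of_int (int h * (poly P (m a) - poly P (m b))) * \<alpha>)))"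
    have "\<alpha> \<in> {real_of_int \<lfloor>\<alpha>\<rfloor>..real_of_int \<lfloor>\<alpha>\<rfloor> + 1}"
      by (auto intro: less_imp_le)
    with all have ev: "\<forall>\<^sub>F k in sequentially.
      \<exists>h\<in>{1..nat \<lceil>real (2 ^ k) powr \<delta>\<rceil>}. real (2 ^ k) / 2 \<le>
        (\<Sum>a=1..2^k. \<Sum>b=1..2^k. cos (2 * pi * real_of_int (int h * (poly P (m a) - poly P (m b))) * \<alpha>))"
      by blast
    have "filterlim (\<lambda>k. (2 powr \<delta>) ^ k) at_top sequentially"
      using \<delta>
      by (intro filterlim_at_infinity_imp_filterlim_at_top filterlim_realpow_sequentially_gt1) auto
    then have ev2: "\<forall>\<^sub>F k in sequentially. 8 * pi \<le> (2 powr \<delta>) ^ k"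
      by (simp add: filterlim_at_top)
    show "\<forall>\<^sub>F k in sequentially. real (2 ^ k) powr (1/2 - 2 * \<delta>)
        \<le> real (2 ^ k) * discrepancy (\<lambda>n. frac (?y n)) (2 ^ k)"
      using ev ev2
    proof eventually_elim
      case (elim k)
      define N :: nat where "N = 2 ^ k"
      define D where "D = real N * discrepancy (\<lambda>n. frac (?y n)) N"
      from elim(1) obtain h where h: "h \<ge> 1" "h \<le> nat \<lceil>real N powr \<delta>\<rceil>" and "real N / 2 \<le>
        (\<Sum>a=1..N. \<Sum>b=1..N. cos (2 * pi * real_of_int (int h * (poly P (m a) - poly P (m b))) * \<alpha>))"
        by (auto simp: N_def)
      then have "real N / 2 \<le> (\<Sum>a=1..N. \<Sum>b=1..N. cos (2 * pi * real h * ?y a - 2 * pi * real h * ?y b))"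
        by (simp add: algebra_simps)
      from discrepancy_ge_of_exponential_sum[OF h(1) this]
      have D: "sqrt (real N) / 2 \<le> 2 * pi * real h * D" by (simp add: D_def)
      have N1: "real N \<ge> 1" by (simp add: N_def)
      have Nd: "real N powr \<delta> = (2 powr \<delta>) ^ k"
        by (simp add: N_def powr_powr mult.commute flip: powr_realpow)
      have "real N powr \<delta> \<ge> 1"
        using N1 \<delta> by (intro ge_one_powr_ge_zero) auto
      \<comment> \<open>Rounding up at most doubles a number that is at least 1.\<close>
      then have hle: "real h \<le> 2 * real N powr \<delta>" using h(2) by linarith
      have D0: "D \<ge> 0"
        using count_in_diff_le_discrepancy[of 0 1 "\<lambda>n. frac (?y n)" N] unfolding D_def by linarith
      have "real N powr (1/2 - 2 * \<delta>) * (real N powr \<delta> * real N powr \<delta>) = sqrt (real N)"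
        using N1 by (simp add: powr_half_sqrt flip: powr_add)
      also have "\<dots> \<le> 4 * pi * real h * D" using D by simp
      also have "\<dots> \<le> 4 * pi * (2 * real N powr \<delta>) * D"
        using hle D0 by (intro mult_right_mono mult_left_mono) auto
      also have "\<dots> = (8 * pi) * (real N powr \<delta> * D)" by simp
      also have "\<dots> \<le> real N powr \<delta> * (real N powr \<delta> * D)"
        using elim(2) D0 unfolding Nd by (intro mult_right_mono) auto
      also have "\<dots> = D * (real N powr \<delta> * real N powr \<delta>)" by simp
      finally have "real N powr (1/2 - 2 * \<delta>) \<le> D"
        using N1 by (subst (asm) mult_le_cancel_right_pos) auto
      then show ?case by (simp add: D_def N_def)
    qed
  qed
qed

theorem theorem1:
  fixes P :: "int poly" and m :: "nat \<Rightarrow> int" and t :: nat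
  assumes "degree P \<ge> 2"
    and "inj_on m {1..}"
    and "\<exists>n0. \<forall>n\<ge>n0. real_of_int \<bar>m n\<bar> \<le> real n ^ t"
  shows "AE \<alpha> in lborel. \<forall>\<epsilon>>0. \<exists>\<^sub>\<infinity>N.
     real N * discrepancy (\<lambda>n. frac (real_of_int (poly P (m n)) * \<alpha>)) N
       \<ge> real N powr (1/2 - \<epsilon>)"
proof -
  \<comment> \<open>Only countably many \<open>\<delta> = 1 / Suc q\<close> are used, so that a
    single null set serves every \<open>\<epsilon>\<close>.\<close>
  have "AE \<alpha> in lborel. \<forall>q::nat. \<forall>\<^sub>F k in sequentially. real (2 ^ k) powr (1/2 - 2 * (1 / real (Suc q)))
    \<le> real (2 ^ k) * discrepancy (\<lambda>n. frac (real_of_int (poly P (m n)) * \<alpha>)) (2 ^ k)"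
    unfolding AE_all_countable by (intro allI AE_discrepancy_ge_powr[OF assms]) auto
  then show ?thesis
  proof (eventually_elim, intro allI impI)
    fix \<alpha> \<epsilon> :: real
    let ?D = "discrepancy (\<lambda>n. frac (real_of_int (poly P (m n)) * \<alpha>))"
    assume all: "\<forall>q::nat. \<forall>\<^sub>F k in sequentially.
      real (2 ^ k) powr (1/2 - 2 * (1 / real (Suc q))) \<le> real (2 ^ k) * ?D (2 ^ k)"
      and "\<epsilon> > 0"
    obtain q where q: "inverse (real (Suc q)) < \<epsilon> / 2"
      using reals_Archimedean[of "\<epsilon> / 2"] \<open>\<epsilon> > 0\<close> by auto
    from all obtain k0 where k0: "\<And>k. k \<ge> k0 \<Longrightarrow>
      real (2 ^ k) powr (1/2 - 2 * (1 / real (Suc q))) \<le> real (2 ^ k) * ?D (2 ^ k)"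
      unfolding eventually_sequentially by blast
    show "\<exists>\<^sub>\<infinity>N. real N powr (1/2 - \<epsilon>) \<le> real N * ?D N"
      unfolding INFM_nat
    proof
      fix n
      \<comment> \<open>\<open>k \<ge> k0\<close> makes the bound valid, and
        \<open>k \<ge> n\<close> gives \<open>2 ^ k > n\<close>, so the good \<open>N\<close> are
        unbounded.\<close>
      define k where "k = max k0 n"
      have "real (2 ^ k) powr (1/2 - \<epsilon>) \<le> real (2 ^ k) powr (1/2 - 2 * (1 / real (Suc q)))"
        using q by (intro powr_mono) (auto simp: inverse_eq_divide)
      also have "\<dots> \<le> real (2 ^ k) * ?D (2 ^ k)"
        by (rule k0) (simp add: k_def)
      finally have "real (2 ^ k) powr (1/2 - \<epsilon>) \<le> real (2 ^ k) * ?D (2 ^ k)" .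
      moreover have "n < 2 ^ k"
        using less_exp[of k] unfolding k_def by linarith
      ultimately show "\<exists>N>n. real N powr (1/2 - \<epsilon>) \<le> real N * ?D N" by blast
    qed
  qed
qed

end
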